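(* Every finite simple graph $G$ satisfies \[ \operatorname{lcc}(G)+\chi(G)\le |V(G)|+1 . \]
   Context: $\chi(G)$ is the chromatic number. A clique is a set of pairwise adjacent vertices. An edge-clique cover of $G$ is a family of cliques of $G$ such that both ends of every edge of $G$ lie together in some member of the family. For such a cover $\mathcal C$, the valency of a vertex $v$ is $\operatorname{val}_{\mathcal C}(v)=|\{C\in\mathcal C: v\in C\}|$. The local clique cover number is $\operatorname{lcc}(G)=\min_{\mathcal C}\max_{v\in V(G)}\operatorname{val}_{\mathcal C}(v)$, the minimum taken over all edge-clique covers $\mathcal C$ of $G$. Conventions: $\operatorname{lcc}(G)=0$ for every edgeless graph, and the graph $\varnothing$ with no vertices has $\chi(\varnothing)=\operatorname{lcc}(\varnothing)=0$. *)

theory Defs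
  imports "HOL-Library.Ramsey"
begin

definition simple_graph :: "'a set \<Rightarrow> 'a set set \<Rightarrow> bool" where
  "simple_graph V E \<longleftrightarrow> finite V \<and> E \<subseteq> [V]\<^bsup>2\<^esup>"

definition proper_coloring :: "'a set \<Rightarrow> 'a set set \<Rightarrow> nat \<Rightarrow> ('a \<Rightarrow> nat) \<Rightarrow> bool" where
  "proper_coloring V E k c \<longleftrightarrow>
     c \<in> V \<rightarrow> {..<k} \<and> (\<forall>u\<in>V. \<forall>v\<in>V. {u, v} \<in> E \<longrightarrow> c u \<noteq> c v)"

definition chromatic_number :: "'a set \<Rightarrow> 'a set set \<Rightarrow> nat" where
  "chromatic_number V E = (LEAST k. \<exists>c. proper_coloring V E k c)"

(* The constant clique from Ramsey does not mention the vertex set, hence K \<subseteq> V.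
   The empty family is allowed; it covers exactly the edgeless graphs.
   Families are sets: repeating a clique never lowers a valency, so the minimum in lcc
   is the same as over families with repetition. *)
definition edge_clique_cover :: "'a set \<Rightarrow> 'a set set \<Rightarrow> 'a set set \<Rightarrow> bool" where
  "edge_clique_cover V E \<C> \<longleftrightarrow>
     (\<forall>K\<in>\<C>. K \<subseteq> V \<and> clique K E) \<and> (\<forall>e\<in>E. \<exists>K\<in>\<C>. e \<subseteq> K)"

definition valency :: "'a set set \<Rightarrow> 'a \<Rightarrow> nat" where
  "valency \<C> v = card {K \<in> \<C>. v \<in> K}"

(* Inserting 0 only matters for V = {}, where the maximum is 0 by convention.
   Min ranges over a finite nonempty set when simple_graph V E: covers are subsets of Pow V,
   and E itself is a cover. *)
definition lcc :: "'a set \<Rightarrow> 'a set set \<Rightarrow> nat" where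
  "lcc V E = (MIN \<C>\<in>{\<C>. edge_clique_cover V E \<C>}. Max (insert 0 (valency \<C> ` V)))"

lemma finite_edge_clique_covers:
  assumes "simple_graph V E"
  shows "finite {\<C>. edge_clique_cover V E \<C>}"
proof (rule finite_subset)
  show "{\<C>. edge_clique_cover V E \<C>} \<subseteq> Pow (Pow V)"
    by (auto simp: edge_clique_cover_def)
  show "finite (Pow (Pow V))"
    using assms by (simp add: simple_graph_def)
qed

lemma edge_clique_cover_edges:
  assumes "simple_graph V E"
  shows "edge_clique_cover V E E"
  unfolding edge_clique_cover_def
proof (intro conjI ballI)
  fix K assume "K \<in> E"
  then have "K \<in> [V]\<^bsup>2\<^esup>"
    using assms by (auto simp: simple_graph_def)
  then obtain x y where "x \<in> V" "y \<in> V" and K: "K = {x, y}"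
    by (auto simp: nsets_2_eq)
  then show "K \<subseteq> V" by simp
  show "clique K E"
    using \<open>K \<in> E\<close> by (simp add: K clique_def insert_commute)
qed auto

lemma lcc_edgeless:
  assumes "finite V"
  shows "lcc V {} = 0"
proof -
  let ?f = "\<lambda>\<C>. Max (insert 0 (valency \<C> ` V))"
  have "simple_graph V {}"
    using assms by (simp add: simple_graph_def)
  then have fin: "finite {\<C>. edge_clique_cover V {} \<C>}"
    by (rule finite_edge_clique_covers)
  have "?f {} = 0"
    using assms by (intro Max_eqI) (auto simp: valency_def)
  moreover have "edge_clique_cover V {} {}"
    by (simp add: edge_clique_cover_def)
  ultimately have "0 \<in> ?f ` {\<C>. edge_clique_cover V {} \<C>}"
    by (intro image_eqI[where x = "{}"]) simp_all
  then have "lcc V {} \<le> 0"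
    unfolding lcc_def using fin by (intro Min_le) auto
  then show ?thesis by simp
qed

lemma chromatic_number_no_vertices: "chromatic_number {} {} = 0"
  unfolding chromatic_number_def proper_coloring_def by (rule Least_eq_0) simp

end

theory Submission
  imports Defs
begin

text \<open>
  The proof is by induction on the number of vertices. It produces an edge-clique cover in
  which every valency is at most \<open>b(G) = |V| + 1 - \<chi>(G)\<close>.

  The engine is the Nordhaus--Gaddum inequality: a set of vertices \<open>Y\<close> splits into \<open>l\<close> cliques
  and also into \<open>k\<close> independent sets with \<open>k + l = |Y| + 1\<close>. Applied to a neighbourhood \<open>Y = N(u)\<close>,
  it bounds the number of cliques needed to cover the edges at \<open>u\<close>, because \<open>k\<close> colours on \<open>Y\<close>
  and few colours elsewhere colour all of \<open>G\<close>, so \<open>k\<close> cannot be small compared with \<open>\<chi>(G)\<close>. Since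
  the \<open>l\<close> cliques are disjoint, covering the edges at \<open>u\<close> this way costs each neighbour of \<open>u\<close>
  only one additional clique.

  A complete graph is covered by one clique. Otherwise let \<open>u\<close> and \<open>v\<close> be non-adjacent.

  If \<open>N(u) \<subseteq> N(v)\<close>, then \<open>u\<close> can always receive the colour of \<open>v\<close>, so deleting \<open>u\<close> does not change
  \<open>\<chi>\<close> and lowers \<open>b\<close> by one. The cover of \<open>G - u\<close> then leaves room for the one additional clique
  per vertex that the edges at \<open>u\<close> need.

  If the two neighbourhoods are incomparable, choose \<open>x \<in> N(u) - N(v)\<close> and \<open>y \<in> N(v) - N(u)\<close>. The four
  vertices \<open>u, x, v, y\<close> split into the independent pairs \<open>{u, y}\<close> and \<open>{v, x}\<close>, so deleting them
  lowers \<open>\<chi>\<close> by at most two and hence lowers \<open>b\<close> by at least two. They also split into the edges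
  \<open>{u, x}\<close> and \<open>{v, y}\<close>, and the edges between \<open>{u, x}\<close> and the other vertices can be covered so
  that each other vertex pays only one clique, a vertex adjacent to both \<open>u\<close> and \<open>x\<close> using
  the same clique for both. So two additional cliques per remaining vertex suffice. At \<open>u\<close> itself,
  \<open>N(u)\<close> is now split into two parts, inside and outside \<open>N(x)\<close>, and two uses of Nordhaus--Gaddum
  lose one clique; colouring the four vertices with only two colours gains two.
\<close>

section \<open>Colourings\<close>

definition colorable :: "'a set \<Rightarrow> 'a set set \<Rightarrow> nat \<Rightarrow> bool" where
  "colorable X E k \<longleftrightarrow> (\<exists>c. proper_coloring X E k c)"

lemma colorable_empty: "colorable {} E k"
  by (simp add: colorable_def proper_coloring_def)

lemma colorable_induced: "colorable X (E \<inter> Pow X) k \<longleftrightarrow> colorable X E k"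
  by (simp add: colorable_def proper_coloring_def cong: conj_cong)

lemma colorable_independent:
  assumes "\<And>u v. u \<in> X \<Longrightarrow> v \<in> X \<Longrightarrow> {u, v} \<notin> E"
  shows "colorable X E 1"
  using assms unfolding colorable_def proper_coloring_def
  by (intro exI[of _ "\<lambda>_. 0"]) auto

lemma colorable_Un:
  assumes "colorable X E k" "colorable Y E l"
  shows "colorable (X \<union> Y) E (k + l)"
proof -
  obtain c d where c: "proper_coloring X E k c" and d: "proper_coloring Y E l d"
    using assms by (auto simp: colorable_def)
  have ck: "c u < k" if "u \<in> X" for u
    using c that by (auto simp: proper_coloring_def)
  have dl: "d u < l" if "u \<in> Y" for u
    using d that by (auto simp: proper_coloring_def)
  have cc: "c u \<noteq> c v" if "u \<in> X" "v \<in> X" "{u, v} \<in> E" for u v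
    using c that by (auto simp: proper_coloring_def)
  have dd: "d u \<noteq> d v" if "u \<in> Y" "v \<in> Y" "{u, v} \<in> E" for u v
    using d that by (auto simp: proper_coloring_def)
  let ?f = "\<lambda>u. if u \<in> X then c u else k + d u"
  have "proper_coloring (X \<union> Y) E (k + l) ?f"
    unfolding proper_coloring_def
  proof (intro conjI ballI impI)
    show "?f \<in> X \<union> Y \<rightarrow> {..<k + l}"
      using ck dl by (auto simp: Pi_iff trans_less_add1)
    fix u v assume uv: "u \<in> X \<union> Y" "v \<in> X \<union> Y" "{u, v} \<in> E"
    show "?f u \<noteq> ?f v"
      using uv ck[of u] ck[of v] cc[of u v] dd[of u v] by auto
  qed
  then show ?thesis by (auto simp: colorable_def)
qed

lemma colorable_card:
  assumes "finite X" "\<And>u. u \<in> X \<Longrightarrow> {u} \<notin> E"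
  shows "colorable X E (card X)"
  using assms
proof (induction X rule: finite_induct)
  case empty
  show ?case by (rule colorable_empty)
next
  case (insert x X)
  have "colorable {x} E 1"
    using insert.prems by (intro colorable_independent) auto
  then have "colorable ({x} \<union> X) E (1 + card X)"
    using insert by (intro colorable_Un) auto
  then show ?case using insert by simp
qed

text \<open>
  A colour missing on the neighbours of the new vertex is free for it. It is missing when there are
  fewer neighbours than colours, and also when it comes from a vertex that dominates the new one.
\<close>

lemma colorable_insert:
  assumes "proper_coloring X E k c" "{v} \<notin> E" "i < k"
    and free: "\<And>w. w \<in> X \<Longrightarrow> {v, w} \<in> E \<Longrightarrow> c w \<noteq> i"
  shows "colorable (insert v X) E k"
proof (cases "v \<in> X")
  case True
  then show ?thesis using assms(1) by (auto simp: colorable_def insert_absorb)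
next
  case False
  have "proper_coloring (insert v X) E k (c(v := i))"
    using assms False unfolding proper_coloring_def
    by (auto simp: insert_commute Pi_iff)
  then show ?thesis by (auto simp: colorable_def)
qed

lemma colorable_insert_few_neighbours:
  assumes "colorable X E k" "finite X" "{v} \<notin> E" "card {w \<in> X. {v, w} \<in> E} < k"
  shows "colorable (insert v X) E k"
proof -
  obtain c where c: "proper_coloring X E k c"
    using assms(1) by (auto simp: colorable_def)
  let ?N = "{w \<in> X. {v, w} \<in> E}"
  have "card (c ` ?N) < card {..<k}"
    using assms(2,4) card_image_le[of ?N c] by simp
  then have "\<not> {..<k} \<subseteq> c ` ?N"
    using card_mono[of "c ` ?N" "{..<k}"] assms(2) by auto
  then obtain i where "i < k" "i \<notin> c ` ?N" by auto
  then show ?thesis using colorable_insert[OF c assms(3)] by blast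
qed

text \<open>
  A new vertex has at most \<open>|X| < k + l\<close> neighbours in both graphs together, so one of the two
  graphs has a free colour for it, and the other one may use a new colour. The number \<open>l\<close>, which
  will count cliques, is kept positive even for empty \<open>X\<close>: the books below need at least one page.
\<close>

lemma nordhaus_gaddum:
  assumes "finite X" "E \<inter> F = {}" "\<And>u. u \<in> X \<Longrightarrow> {u} \<notin> E \<and> {u} \<notin> F"
  shows "\<exists>k l. k + l = card X + 1 \<and> 0 < l \<and> colorable X E k \<and> colorable X F l"
  using assms
proof (induction X rule: finite_induct)
  case empty
  show ?case by (intro exI[of _ 0] exI[of _ 1]) (simp add: colorable_empty)
next
  case (insert v X)
  have "\<exists>k l. k + l = card X + 1 \<and> 0 < l \<and> colorable X E k \<and> colorable X F l"
    using insert.prems by (intro insert.IH) simp_all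
  then obtain k l where kl: "k + l = card X + 1" "0 < l" "colorable X E k" "colorable X F l"
    by blast
  have v: "{v} \<notin> E" "{v} \<notin> F" using insert.prems(2) by simp_all
  have vE: "colorable {v} E 1" using v(1) by (intro colorable_independent) simp
  have vF: "colorable {v} F 1" using v(2) by (intro colorable_independent) simp
  have cardX: "card (insert v X) = card X + 1" using insert.hyps by simp
  have "{w \<in> X. {v, w} \<in> E} \<inter> {w \<in> X. {v, w} \<in> F} = {}"
    using insert.prems(1) by blast
  then have "card {w \<in> X. {v, w} \<in> E} + card {w \<in> X. {v, w} \<in> F}
      = card ({w \<in> X. {v, w} \<in> E} \<union> {w \<in> X. {v, w} \<in> F})"
    using insert.hyps(1) by (intro card_Un_disjoint[symmetric]) simp_all
  also have "\<dots> \<le> card X"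
    using insert.hyps(1) by (intro card_mono) auto
  finally have "card {w \<in> X. {v, w} \<in> E} < k \<or> card {w \<in> X. {v, w} \<in> F} < l"
    using kl(1) by linarith
  then show ?case
  proof
    assume "card {w \<in> X. {v, w} \<in> E} < k"
    then have "colorable (insert v X) E k"
      by (rule colorable_insert_few_neighbours[OF kl(3) insert.hyps(1) v(1)])
    moreover have "colorable (insert v X) F (l + 1)"
      using colorable_Un[OF kl(4) vF] by simp
    moreover have "k + (l + 1) = card (insert v X) + 1" "0 < l + 1"
      using kl(1) cardX by linarith+
    ultimately show ?thesis by (intro exI[of _ k] exI[of _ "l + 1"] conjI)
  next
    assume "card {w \<in> X. {v, w} \<in> F} < l"
    then have "colorable (insert v X) F l"
      by (rule colorable_insert_few_neighbours[OF kl(4) insert.hyps(1) v(2)])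
    moreover have "colorable (insert v X) E (k + 1)"
      using colorable_Un[OF kl(3) vE] by simp
    moreover have "(k + 1) + l = card (insert v X) + 1"
      using kl(1) cardX by linarith
    ultimately show ?thesis
      using kl(2) by (intro exI[of _ "k + 1"] exI[of _ l] conjI)
  qed
qed

lemma no_loops: "simple_graph V E \<Longrightarrow> {u} \<notin> E"
  by (auto simp: simple_graph_def nsets_def)

lemma colorable_nonadjacent:
  assumes "simple_graph V E" "{u, v} \<notin> E"
  shows "colorable {u, v} E 1"
  using assms(2) no_loops[OF assms(1)]
  by (intro colorable_independent) (auto simp: insert_commute)

lemma edgeE:
  assumes "simple_graph V E" "e \<in> E"
  obtains p q where "e = {p, q}" "p \<noteq> q" "p \<in> V" "q \<in> V"
proof -
  have "e \<in> [V]\<^bsup>2\<^esup>" using assms by (auto simp: simple_graph_def)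
  then obtain p q where "p \<in> V" "q \<in> V - {p}" "e = {p, q}"
    unfolding nsets_2_eq by blast
  then show thesis by (intro that[of p q]) auto
qed

lemma simple_graph_induced:
  assumes "simple_graph V E" "W \<subseteq> V"
  shows "simple_graph W (E \<inter> Pow W)"
  using assms finite_subset[of W V] by (auto simp: simple_graph_def nsets_def)

lemma chromatic_number_le: "colorable V E k \<Longrightarrow> chromatic_number V E \<le> k"
  by (auto simp: chromatic_number_def colorable_def intro: Least_le)

lemma colorable_chromatic_number:
  assumes "simple_graph V E"
  shows "colorable V E (chromatic_number V E)"
proof -
  have "colorable V E (card V)"
    using assms no_loops[OF assms] by (intro colorable_card) (auto simp: simple_graph_def)
  then show ?thesis
    unfolding chromatic_number_def colorable_def by (rule LeastI)
qed

lemma chromatic_number_le_remove: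
  assumes "simple_graph V E" "W \<subseteq> V" "colorable (V - W) E k"
  shows "chromatic_number V E \<le> chromatic_number W (E \<inter> Pow W) + k"
proof -
  have "colorable W E (chromatic_number W (E \<inter> Pow W))"
    using colorable_chromatic_number[OF simple_graph_induced[OF assms(1,2)]]
    by (simp add: colorable_induced)
  then have "colorable (W \<union> (V - W)) E (chromatic_number W (E \<inter> Pow W) + k)"
    using assms(3) by (rule colorable_Un)
  moreover have "W \<union> (V - W) = V" using assms(2) by blast
  ultimately show ?thesis by (simp add: chromatic_number_le)
qed

text \<open>
  The estimate that turns the number of colours on a neighbourhood \<open>Y\<close> into a bound for the whole
  graph: outside \<open>Y \<union> R\<close> every vertex may have its own colour.
\<close>

lemma chromatic_number_le_cover:
  assumes "simple_graph V E" "Y \<subseteq> V" "R \<subseteq> V" "Y \<inter> R = {}"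
    and "colorable Y E k" "colorable R E r"
  shows "chromatic_number V E + card Y + card R \<le> k + r + card V"
proof -
  have fin: "finite V" using assms(1) by (simp add: simple_graph_def)
  have finYR: "finite Y" "finite R" using assms(2,3) fin finite_subset by auto
  let ?Z = "V - (Y \<union> R)"
  have "colorable ?Z E (card ?Z)"
    using fin no_loops[OF assms(1)] by (intro colorable_card) auto
  then have "colorable ((Y \<union> R) \<union> ?Z) E (k + r + card ?Z)"
    by (intro colorable_Un assms)
  moreover have "(Y \<union> R) \<union> ?Z = V" using assms by auto
  ultimately have "chromatic_number V E \<le> k + r + card ?Z"
    by (simp add: chromatic_number_le)
  moreover have "card ?Z + card (Y \<union> R) = card V"
    using assms(2,3) fin finYR card_mono[of V "Y \<union> R"] by (simp add: card_Diff_subset)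
  moreover have "card (Y \<union> R) = card Y + card R"
    using assms(4) finYR by (rule card_Un_disjoint[rotated 2])
  ultimately show ?thesis by linarith
qed

section \<open>Families of cliques and their valencies\<close>

lemma valency_Un_le: "valency (\<C> \<union> \<D>) v \<le> valency \<C> v + valency \<D> v"
proof -
  have "{K \<in> \<C> \<union> \<D>. v \<in> K} = {K \<in> \<C>. v \<in> K} \<union> {K \<in> \<D>. v \<in> K}" by blast
  then show ?thesis unfolding valency_def by (metis card_Un_le)
qed

lemma valency_eq_0: "v \<notin> \<Union>\<D> \<Longrightarrow> valency \<D> v = 0"
  by (auto simp: valency_def card_eq_0_iff)

lemma valency_le_card: "finite \<D> \<Longrightarrow> valency \<D> v \<le> card \<D>"
  unfolding valency_def by (intro card_mono) auto

lemma edge_clique_cover_extend: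
  assumes "edge_clique_cover W (E \<inter> Pow W) \<C>" "W \<subseteq> V"
    and "\<And>K. K \<in> \<D> \<Longrightarrow> K \<subseteq> V \<and> clique K E"
    and "\<And>e. e \<in> E \<Longrightarrow> \<not> e \<subseteq> W \<Longrightarrow> \<exists>K\<in>\<D>. e \<subseteq> K"
  shows "edge_clique_cover V E (\<C> \<union> \<D>)"
  unfolding edge_clique_cover_def
proof (intro conjI ballI)
  fix K assume "K \<in> \<C> \<union> \<D>"
  then have "K \<subseteq> V \<and> clique K E"
  proof
    assume "K \<in> \<C>"
    then show ?thesis
      using assms(1,2) by (auto simp: edge_clique_cover_def clique_def)
  qed (rule assms(3))
  then show "K \<subseteq> V" "clique K E" by simp_all
next
  fix e assume e: "e \<in> E"
  show "\<exists>K\<in>\<C> \<union> \<D>. e \<subseteq> K"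
  proof (cases "e \<subseteq> W")
    case True
    then have "\<exists>K\<in>\<C>. e \<subseteq> K"
      using e assms(1) by (simp add: edge_clique_cover_def)
    then show ?thesis by blast
  next
    case False
    then show ?thesis using assms(4)[OF e] by blast
  qed
qed

lemma lcc_le:
  assumes "simple_graph V E" "edge_clique_cover V E \<C>" "\<And>v. v \<in> V \<Longrightarrow> valency \<C> v \<le> b"
  shows "lcc V E \<le> b"
proof -
  have "lcc V E \<le> Max (insert 0 (valency \<C> ` V))"
    unfolding lcc_def
  proof (rule Min_le)
    show "Max (insert 0 (valency \<C> ` V))
        \<in> (\<lambda>\<C>. Max (insert 0 (valency \<C> ` V))) ` {\<C>. edge_clique_cover V E \<C>}"
      using assms(2) by (intro imageI CollectI)
  qed (intro finite_imageI finite_edge_clique_covers assms(1))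
  also have "\<dots> \<le> b"
    using assms by (auto simp: simple_graph_def)
  finally show ?thesis .
qed

text \<open>
  Splitting the common neighbourhood \<open>Y\<close> of a clique \<open>T\<close> into disjoint cliques and adding \<open>T\<close> to
  each of them covers all edges between \<open>T\<close> and \<open>Y\<close>, at a price of one clique for each member of \<open>Y\<close>.
  The family is non-empty even if \<open>Y\<close> is empty, so that the edges inside \<open>T\<close> are covered too.
\<close>

lemma book_cover:
  assumes "simple_graph V E" "T \<subseteq> V" "Y \<subseteq> V" "clique T E" "T \<inter> Y = {}"
    and adj: "\<And>t y. t \<in> T \<Longrightarrow> y \<in> Y \<Longrightarrow> {t, y} \<in> E"
  obtains \<D> k where "finite \<D>" "\<D> \<noteq> {}" "colorable Y E k" "k + card \<D> \<le> card Y + 1"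
    "\<And>K. K \<in> \<D> \<Longrightarrow> T \<subseteq> K \<and> K \<subseteq> T \<union> Y \<and> clique K E"
    "\<And>y. y \<in> Y \<Longrightarrow> \<exists>K\<in>\<D>. y \<in> K" "\<And>y. y \<in> Y \<Longrightarrow> valency \<D> y \<le> 1"
proof -
  have finY: "finite Y"
    using assms(1,3) finite_subset by (auto simp: simple_graph_def)
  let ?F = "[Y]\<^bsup>2\<^esup> - E"
  obtain k l where kl: "k + l = card Y + 1" "0 < l" "colorable Y E k" "colorable Y ?F l"
  proof -
    have "{u} \<notin> ?F" for u by (simp add: nsets_def)
    then have "\<exists>k l. k + l = card Y + 1 \<and> 0 < l \<and> colorable Y E k \<and> colorable Y ?F l"
      using no_loops[OF assms(1)] by (intro nordhaus_gaddum finY) blast+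
    then show thesis using that by blast
  qed
  from kl(4) obtain c where c: "proper_coloring Y ?F l c"
    unfolding colorable_def by blast
  define P where "P i = T \<union> {y \<in> Y. c y = i}" for i
  let ?D = "P ` {..<l}"
  have cl: "c y < l" if "y \<in> Y" for y
    using c that unfolding proper_coloring_def by blast
  have same: "{y, z} \<in> E" if "y \<in> Y" "z \<in> Y" "c y = c z" "y \<noteq> z" for y z
  proof -
    have "{y, z} \<in> [Y]\<^bsup>2\<^esup>" using that by (simp add: nsets_def)
    moreover have "{y, z} \<notin> ?F" using c that unfolding proper_coloring_def by blast
    ultimately show ?thesis by blast
  qed
  have cliq: "clique (P i) E" for i
    unfolding clique_def
  proof (intro ballI impI)
    fix p q assume "p \<in> P i" "q \<in> P i" and neq: "p \<noteq> q"
    then consider "p \<in> T" "q \<in> T" | "p \<in> T" "q \<in> Y" | "q \<in> T" "p \<in> Y"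
      | "p \<in> Y" "q \<in> Y" "c p = c q"
      by (auto simp: P_def)
    then show "{p, q} \<in> E"
    proof cases
      case 1
      then show ?thesis using assms(4) neq unfolding clique_def by blast
    next
      case 3
      then show ?thesis using adj[of q p] by (simp add: insert_commute)
    next
      case 4
      then show ?thesis using neq by (rule same)
    qed (rule adj)
  qed
  show thesis
  proof (rule that[of ?D k])
    show "?D \<noteq> {}" using kl(2) by auto
    show "k + card ?D \<le> card Y + 1"
      using kl(1) card_image_le[of "{..<l}" P] by simp
    show "T \<subseteq> K \<and> K \<subseteq> T \<union> Y \<and> clique K E" if "K \<in> ?D" for K
      using that cliq by (auto simp: P_def)
    fix y assume y: "y \<in> Y"
    show "\<exists>K\<in>?D. y \<in> K" using y cl by (auto simp: P_def)
    have "{K \<in> ?D. y \<in> K} \<subseteq> {P (c y)}"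
      using y assms(5) by (auto simp: P_def)
    then have "card {K \<in> ?D. y \<in> K} \<le> card {P (c y)}" by (intro card_mono) auto
    then show "valency ?D y \<le> 1" by (simp add: valency_def)
  qed (use kl in auto)
qed

text \<open>
  For an edge \<open>{a, b}\<close> the vertices of \<open>W\<close> adjacent to an end are of three kinds, and each kind gets its
  own book: over \<open>{a, b}\<close> for the common neighbours, over \<open>{a}\<close> or \<open>{b}\<close> for the others. Only two of
  the books contain \<open>a\<close>, which accounts for the summand 2 in the bound on its valency.
\<close>

lemma edge_star_cover:
  assumes G: "simple_graph V E" and ab: "{a, b} \<in> E" and W: "W \<subseteq> V - {a, b}"
  obtains \<D> where "\<And>K. K \<in> \<D> \<Longrightarrow> K \<subseteq> insert a (insert b W) \<and> clique K E"
    "\<exists>K\<in>\<D>. {a, b} \<subseteq> K"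
    "\<And>t w. t \<in> {a, b} \<Longrightarrow> w \<in> W \<Longrightarrow> {t, w} \<in> E \<Longrightarrow> \<exists>K\<in>\<D>. {t, w} \<subseteq> K"
    "\<And>w. w \<in> W \<Longrightarrow> valency \<D> w \<le> 1"
    "\<And>t. t \<in> {a, b} \<Longrightarrow> \<exists>k. colorable {w \<in> W. {t, w} \<in> E} E k
        \<and> valency \<D> t + k \<le> card {w \<in> W. {t, w} \<in> E} + 2"
proof -
  have abV: "a \<in> V" "b \<in> V" "a \<noteq> b"
    using G ab no_loops[OF G] by (auto simp: simple_graph_def nsets_def)
  have finW: "finite W"
    using G W finite_subset[of W V] by (auto simp: simple_graph_def)
  let ?N = "\<lambda>t. {w \<in> W. {t, w} \<in> E}"
  define X where "X = ?N a \<inter> ?N b"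
  define A where "A = ?N a - ?N b"
  define B where "B = ?N b - ?N a"
  have fin: "finite X" "finite A" "finite B"
    using finW by (auto simp: X_def A_def B_def)
  obtain DX kX where X: "finite DX" "DX \<noteq> {}" "colorable X E kX" "kX + card DX \<le> card X + 1"
    "\<And>K. K \<in> DX \<Longrightarrow> {a, b} \<subseteq> K \<and> K \<subseteq> {a, b} \<union> X \<and> clique K E"
    "\<And>y. y \<in> X \<Longrightarrow> \<exists>K\<in>DX. y \<in> K" "\<And>y. y \<in> X \<Longrightarrow> valency DX y \<le> 1"
    by (rule book_cover[OF G, of "{a, b}" X])
      (use abV W ab in \<open>auto simp: X_def clique_def insert_commute\<close>)
  obtain DA kA where A: "finite DA" "DA \<noteq> {}" "colorable A E kA" "kA + card DA \<le> card A + 1"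
    "\<And>K. K \<in> DA \<Longrightarrow> {a} \<subseteq> K \<and> K \<subseteq> {a} \<union> A \<and> clique K E"
    "\<And>y. y \<in> A \<Longrightarrow> \<exists>K\<in>DA. y \<in> K" "\<And>y. y \<in> A \<Longrightarrow> valency DA y \<le> 1"
    by (rule book_cover[OF G, of "{a}" A]) (use abV W in \<open>auto simp: A_def clique_def\<close>)
  obtain DB kB where B: "finite DB" "DB \<noteq> {}" "colorable B E kB" "kB + card DB \<le> card B + 1"
    "\<And>K. K \<in> DB \<Longrightarrow> {b} \<subseteq> K \<and> K \<subseteq> {b} \<union> B \<and> clique K E"
    "\<And>y. y \<in> B \<Longrightarrow> \<exists>K\<in>DB. y \<in> K" "\<And>y. y \<in> B \<Longrightarrow> valency DB y \<le> 1"
    by (rule book_cover[OF G, of "{b}" B]) (use abV W in \<open>auto simp: B_def clique_def\<close>)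
  let ?D = "DX \<union> DA \<union> DB"
  have val: "valency ?D v \<le> valency DX v + valency DA v + valency DB v" for v
    using valency_Un_le[of "DX \<union> DA" DB v] valency_Un_le[of DX DA v] by linarith
  have zX: "valency DX v = 0" if "v \<notin> {a, b} \<union> X" for v
    using X(5) that by (intro valency_eq_0) blast
  have zA: "valency DA v = 0" if "v \<notin> {a} \<union> A" for v
    using A(5) that by (intro valency_eq_0) blast
  have zB: "valency DB v = 0" if "v \<notin> {b} \<union> B" for v
    using B(5) that by (intro valency_eq_0) blast
  have disj: "X \<inter> A = {}" "X \<inter> B = {}" "A \<inter> B = {}"
    by (auto simp: X_def A_def B_def)
  have NA: "?N a = X \<union> A" and NB: "?N b = X \<union> B"
    by (auto simp: X_def A_def B_def)
  have sub: "X \<subseteq> W" "A \<subseteq> W" "B \<subseteq> W" by (auto simp: X_def A_def B_def)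
  show thesis
  proof (rule that[of ?D])
    show "K \<subseteq> insert a (insert b W) \<and> clique K E" if "K \<in> ?D" for K
    proof -
      consider "K \<in> DX" | "K \<in> DA" | "K \<in> DB" using \<open>K \<in> ?D\<close> by blast
      then show ?thesis
      proof cases
        case 1
        then show ?thesis using X(5)[OF 1] sub(1) by auto
      next
        case 2
        then show ?thesis using A(5)[OF 2] sub(2) by auto
      next
        case 3
        then show ?thesis using B(5)[OF 3] sub(3) by auto
      qed
    qed
    obtain K where K: "K \<in> DX" using X(2) by blast
    then show "\<exists>K\<in>?D. {a, b} \<subseteq> K"
      using X(5)[OF K] by (intro bexI[of _ K]) simp_all
    show "\<exists>K\<in>?D. {t, w} \<subseteq> K" if "t \<in> {a, b}" "w \<in> W" "{t, w} \<in> E" for t w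
    proof -
      have "w \<in> X \<or> t = a \<and> w \<in> A \<or> t = b \<and> w \<in> B"
        using that by (auto simp: X_def A_def B_def)
      then show ?thesis
      proof (elim disjE conjE)
        assume "w \<in> X"
        then obtain K where "K \<in> DX" "w \<in> K" using X(6) by blast
        then show ?thesis using X(5)[of K] \<open>t \<in> {a, b}\<close> by (intro bexI[of _ K]) auto
      next
        assume t: "t = a" and "w \<in> A"
        then obtain K where "K \<in> DA" "w \<in> K" using A(6) by blast
        then show ?thesis using A(5)[of K] t by (intro bexI[of _ K]) auto
      next
        assume t: "t = b" and "w \<in> B"
        then obtain K where "K \<in> DB" "w \<in> K" using B(6) by blast
        then show ?thesis using B(5)[of K] t by (intro bexI[of _ K]) auto
      qed
    qed
    show "valency ?D w \<le> 1" if w: "w \<in> W" for w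
    proof -
      have wab: "w \<noteq> a" "w \<noteq> b" using w W by auto
      consider "w \<in> X" "w \<notin> A" "w \<notin> B" | "w \<notin> X" "w \<in> A" "w \<notin> B"
        | "w \<notin> X" "w \<notin> A" "w \<in> B" | "w \<notin> X" "w \<notin> A" "w \<notin> B"
        using disj by blast
      then show ?thesis
        using val[of w] X(7)[of w] A(7)[of w] B(7)[of w] zX[of w] zA[of w] zB[of w] wab
        by cases auto
    qed
    show "\<exists>k. colorable (?N t) E k \<and> valency ?D t + k \<le> card (?N t) + 2" if "t \<in> {a, b}" for t
    proof -
      have notin: "a \<notin> B" "b \<notin> A" using sub W by auto
      consider "t = a" | "t = b" using \<open>t \<in> {a, b}\<close> by blast
      then show ?thesis
      proof cases
        case 1
        have "valency ?D a \<le> card DX + card DA"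
          using val[of a] valency_le_card[OF X(1), of a] valency_le_card[OF A(1), of a] zB[of a]
            notin abV by simp
        moreover have "card (?N a) = card X + card A"
          unfolding NA using fin disj by (intro card_Un_disjoint)
        ultimately show ?thesis
          unfolding 1 using X(4) A(4) colorable_Un[OF X(3) A(3)]
          by (intro exI[of _ "kX + kA"]) (simp add: NA)
      next
        case 2
        have "valency ?D b \<le> card DX + card DB"
          using val[of b] valency_le_card[OF X(1), of b] valency_le_card[OF B(1), of b] zA[of b]
            notin abV by simp
        moreover have "card (?N b) = card X + card B"
          unfolding NB using fin disj by (intro card_Un_disjoint)
        ultimately show ?thesis
          unfolding 2 using X(4) B(4) colorable_Un[OF X(3) B(3)]
          by (intro exI[of _ "kX + kB"]) (simp add: NB)
      qed
    qed
  qed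
qed

section \<open>The induction\<close>

definition good_cover :: "'a set \<Rightarrow> 'a set set \<Rightarrow> 'a set set \<Rightarrow> bool" where
  "good_cover V E \<C> \<longleftrightarrow> edge_clique_cover V E \<C> \<and>
     (\<forall>v\<in>V. valency \<C> v + chromatic_number V E \<le> card V + 1)"

lemma good_cover_complete:
  assumes G: "simple_graph V E" and complete: "clique V E"
  shows "good_cover V E {V}"
proof -
  have "chromatic_number V E \<le> card V"
    using G no_loops[OF G]
    by (intro chromatic_number_le colorable_card) (auto simp: simple_graph_def)
  moreover have "edge_clique_cover V E {V}"
    using G complete by (auto simp: edge_clique_cover_def simple_graph_def nsets_def)
  moreover have "valency {V} v \<le> 1" for v
    using valency_le_card[of "{V}" v] by simp
  ultimately show ?thesis
    unfolding good_cover_def by (metis add.commute add_mono)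
qed

text \<open>
  Deleting \<open>u\<close> keeps the chromatic number, as \<open>u\<close> can copy the colour of \<open>v\<close>. For the same reason the
  bound on the valency of \<open>u\<close> holds: the pair \<open>{u, v}\<close> costs only one colour.
\<close>

lemma good_cover_dominated:
  assumes G: "simple_graph V E" and uv: "u \<in> V" "v \<in> V" "u \<noteq> v" "{u, v} \<notin> E"
    and dom: "\<And>w. {u, w} \<in> E \<Longrightarrow> {v, w} \<in> E"
    and IH: "good_cover (V - {u}) (E \<inter> Pow (V - {u})) \<C>"
  shows "\<exists>\<C>'. good_cover V E \<C>'"
proof -
  let ?W = "V - {u}" and ?Y = "{w \<in> V. {u, w} \<in> E}"
  let ?EW = "E \<inter> Pow ?W"
  have fin: "finite V" using G by (simp add: simple_graph_def)
  have cover: "edge_clique_cover ?W ?EW \<C>"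
    and val: "\<And>w. w \<in> ?W \<Longrightarrow> valency \<C> w + chromatic_number ?W ?EW \<le> card ?W + 1"
    using IH by (auto simp: good_cover_def)
  have chi: "chromatic_number V E \<le> chromatic_number ?W ?EW"
  proof -
    have "colorable ?W E (chromatic_number ?W ?EW)"
      using colorable_chromatic_number[OF simple_graph_induced[OF G, of ?W]]
      by (simp add: colorable_induced)
    then obtain c where c: "proper_coloring ?W E (chromatic_number ?W ?EW) c"
      by (auto simp: colorable_def)
    have "colorable (insert u ?W) E (chromatic_number ?W ?EW)"
    proof (rule colorable_insert[OF c no_loops[OF G], of "c v"])
      show "c v < chromatic_number ?W ?EW"
        using c uv by (auto simp: proper_coloring_def)
      show "c w \<noteq> c v" if "w \<in> ?W" "{u, w} \<in> E" for w
      proof -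
        have "{v, w} \<in> E" "v \<in> ?W" using that(2) dom uv by auto
        then have "c v \<noteq> c w" using c that(1) unfolding proper_coloring_def by blast
        then show ?thesis by simp
      qed
    qed
    then show ?thesis using uv(1) by (simp add: chromatic_number_le insert_absorb)
  qed
  have cardW: "card ?W + 1 = card V" using uv(1) fin by (metis Suc_eq_plus1 card.remove)
  have uY: "u \<notin> ?Y" "v \<notin> ?Y" using no_loops[OF G, of u] uv(4) by auto
  obtain \<D> k where D: "finite \<D>" "\<D> \<noteq> {}" "colorable ?Y E k" "k + card \<D> \<le> card ?Y + 1"
    "\<And>K. K \<in> \<D> \<Longrightarrow> {u} \<subseteq> K \<and> K \<subseteq> {u} \<union> ?Y \<and> clique K E"
    "\<And>y. y \<in> ?Y \<Longrightarrow> \<exists>K\<in>\<D>. y \<in> K" "\<And>y. y \<in> ?Y \<Longrightarrow> valency \<D> y \<le> 1"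
    by (rule book_cover[OF G, of "{u}" ?Y]) (use uv uY in \<open>auto simp: clique_def\<close>)
  have pair: "colorable {u, v} E 1"
    using colorable_nonadjacent[OF G uv(4)] .
  have "chromatic_number V E + card ?Y + card {u, v} \<le> k + 1 + card V"
    using uv(1,2) uY by (intro chromatic_number_le_cover[OF G _ _ _ D(3) pair]) auto
  then have valu: "valency \<D> u + chromatic_number V E \<le> card V"
    using D(4) valency_le_card[OF D(1), of u] uv(3) by simp
  have val1: "valency \<D> w \<le> 1" if "w \<noteq> u" for w
  proof (cases "w \<in> ?Y")
    case False
    then have "valency \<D> w = 0" using that D(5) by (intro valency_eq_0) blast
    then show ?thesis by simp
  qed (rule D(7))
  have "edge_clique_cover V E (\<C> \<union> \<D>)"
  proof (rule edge_clique_cover_extend[OF cover])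
    show "K \<subseteq> V \<and> clique K E" if "K \<in> \<D>" for K
      using D(5)[OF that] uv(1) by auto
    fix e assume e: "e \<in> E" "\<not> e \<subseteq> ?W"
    obtain p q where "e = {p, q}" "p \<in> V" "q \<in> V"
      using edgeE[OF G e(1)] by metis
    with e(2) have "p = u \<or> q = u" by auto
    with \<open>e = {p, q}\<close> \<open>p \<in> V\<close> \<open>q \<in> V\<close> obtain w where w: "e = {u, w}" "w \<in> V"
      by auto
    then have "w \<in> ?Y" using e by simp
    then obtain K where "K \<in> \<D>" "w \<in> K" using D(6) by blast
    then show "\<exists>K\<in>\<D>. e \<subseteq> K" using D(5)[of K] w by (intro bexI[of _ K]) auto
  qed auto
  moreover have "valency (\<C> \<union> \<D>) w + chromatic_number V E \<le> card V + 1" if "w \<in> V" for w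
  proof (cases "w = u")
    case True
    have "valency \<C> u = 0"
      using cover by (intro valency_eq_0) (auto simp: edge_clique_cover_def)
    then show ?thesis using valency_Un_le[of \<C> \<D> u] valu True by simp
  next
    case False
    then show ?thesis
      using valency_Un_le[of \<C> \<D> w] val[of w] val1[of w] chi cardW that by simp
  qed
  ultimately show ?thesis unfolding good_cover_def by blast
qed

text \<open>
  Of the six pairs in \<open>{u, x, v, y}\<close>, three are non-adjacent, two are covered by the two edge stars, and
  \<open>{x, y}\<close>, if it is an edge, becomes a clique of its own. The bound for a star leaves each of the
  four vertices one clique to spare, which pays for \<open>{x, y}\<close>.
\<close>

lemma good_cover_incomparable:
  assumes G: "simple_graph V E"
    and non: "{u, v} \<notin> E" "{u, y} \<notin> E" "{v, x} \<notin> E"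
    and edges: "{u, x} \<in> E" "{v, y} \<in> E"
    and IH: "good_cover (V - {u, x, v, y}) (E \<inter> Pow (V - {u, x, v, y})) \<C>"
  shows "\<exists>\<C>'. good_cover V E \<C>'"
proof -
  define R where "R = {u, x, v, y}"
  define W where "W = V - R"
  let ?EW = "E \<inter> Pow W"
  have fin: "finite V" using G by (simp add: simple_graph_def)
  have RV: "R \<subseteq> V"
    using G edges by (auto simp: R_def simple_graph_def nsets_def)
  have dist: "u \<noteq> x" "v \<noteq> y" "u \<noteq> v" "x \<noteq> y" "u \<noteq> y" "x \<noteq> v"
    using edges non no_loops[OF G] by (auto simp: insert_commute)
  have cardR: "card R = 4" using dist by (simp add: R_def)
  have cardW: "card W + 4 = card V"
    using RV fin cardR card_mono[OF fin RV] by (simp add: W_def card_Diff_subset finite_subset)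
  have cover: "edge_clique_cover W ?EW \<C>"
    and val: "\<And>w. w \<in> W \<Longrightarrow> valency \<C> w + chromatic_number W ?EW \<le> card W + 1"
    using IH by (auto simp: good_cover_def W_def R_def)
  have colR: "colorable R E 2"
  proof -
    have "colorable {u, y} E 1" "colorable {v, x} E 1"
      using colorable_nonadjacent[OF G] non by blast+
    then have "colorable ({u, y} \<union> {v, x}) E (1 + 1)" by (rule colorable_Un)
    moreover have "{u, y} \<union> {v, x} = R" by (auto simp: R_def)
    ultimately show ?thesis by (metis one_add_one)
  qed
  have "V - W = R" using RV by (auto simp: W_def)
  then have chi: "chromatic_number V E \<le> chromatic_number W ?EW + 2"
    using colR by (intro chromatic_number_le_remove[OF G]) (auto simp: W_def)
  obtain DU where U: "\<And>K. K \<in> DU \<Longrightarrow> K \<subseteq> insert u (insert x W) \<and> clique K E"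
    "\<exists>K\<in>DU. {u, x} \<subseteq> K"
    "\<And>t w. t \<in> {u, x} \<Longrightarrow> w \<in> W \<Longrightarrow> {t, w} \<in> E \<Longrightarrow> \<exists>K\<in>DU. {t, w} \<subseteq> K"
    "\<And>w. w \<in> W \<Longrightarrow> valency DU w \<le> 1"
    "\<And>t. t \<in> {u, x} \<Longrightarrow> \<exists>k. colorable {w \<in> W. {t, w} \<in> E} E k
        \<and> valency DU t + k \<le> card {w \<in> W. {t, w} \<in> E} + 2"
    by (rule edge_star_cover[OF G edges(1), of W]) (auto simp: W_def R_def)
  obtain DV where D: "\<And>K. K \<in> DV \<Longrightarrow> K \<subseteq> insert v (insert y W) \<and> clique K E"
    "\<exists>K\<in>DV. {v, y} \<subseteq> K"
    "\<And>t w. t \<in> {v, y} \<Longrightarrow> w \<in> W \<Longrightarrow> {t, w} \<in> E \<Longrightarrow> \<exists>K\<in>DV. {t, w} \<subseteq> K"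
    "\<And>w. w \<in> W \<Longrightarrow> valency DV w \<le> 1"
    "\<And>t. t \<in> {v, y} \<Longrightarrow> \<exists>k. colorable {w \<in> W. {t, w} \<in> E} E k
        \<and> valency DV t + k \<le> card {w \<in> W. {t, w} \<in> E} + 2"
    by (rule edge_star_cover[OF G edges(2), of W]) (auto simp: W_def R_def)
  define DE where "DE = {{x, y}} \<inter> E"
  let ?D = "DU \<union> DV \<union> DE"
  have DE: "valency DE t \<le> 1" for t
    using valency_le_card[of DE t] card_mono[of "{{x, y}}" DE] by (simp add: DE_def)
  have DE0: "valency DE w = 0" if "w \<in> W" for w
    using that by (intro valency_eq_0) (auto simp: DE_def W_def R_def)
  have star: "valency \<S> t + chromatic_number V E \<le> card V"
    if ex: "\<exists>k. colorable {w \<in> W. {t, w} \<in> E} E k \<and> valency \<S> t + k \<le> card {w \<in> W. {t, w} \<in> E} + 2"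
    for \<S> t
  proof -
    let ?N = "{w \<in> W. {t, w} \<in> E}"
    obtain k where k: "colorable ?N E k" "valency \<S> t + k \<le> card ?N + 2" using ex by blast
    have "chromatic_number V E + card ?N + card R \<le> k + 2 + card V"
      using RV by (intro chromatic_number_le_cover[OF G _ _ _ k(1) colR]) (auto simp: W_def)
    then show ?thesis using k(2) cardR by linarith
  qed
  have valD: "valency (\<C> \<union> ?D) t \<le> valency \<C> t + valency DU t + valency DV t + valency DE t" for t
    using valency_Un_le[of \<C> ?D t] valency_Un_le[of "DU \<union> DV" DE t] valency_Un_le[of DU DV t]
    by linarith
  have "edge_clique_cover V E (\<C> \<union> ?D)"
  proof (rule edge_clique_cover_extend[OF cover])
    show "K \<subseteq> V \<and> clique K E" if "K \<in> ?D" for K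
      using that U(1)[of K] D(1)[of K] RV
      by (auto simp: W_def R_def DE_def clique_def insert_commute)
    fix e assume e: "e \<in> E" "\<not> e \<subseteq> W"
    obtain p q where pq: "e = {p, q}" "p \<in> V" "q \<in> V"
      using edgeE[OF G e(1)] by metis
    with e(2) have "p \<in> R \<or> q \<in> R" by (auto simp: W_def)
    then obtain t w where tw: "e = {t, w}" "t \<in> R" "w \<in> V"
      using pq by (metis insert_commute)
    then have twE: "{t, w} \<in> E" using e by simp
    show "\<exists>K\<in>?D. e \<subseteq> K"
    proof (cases "w \<in> W")
      case True
      then show ?thesis
        using U(3)[of t w] D(3)[of t w] twE tw by (auto simp: R_def)
    next
      case False
      then have "w \<in> R" using tw by (auto simp: W_def)
      then have "e = {u, x} \<or> e = {v, y} \<or> e = {x, y}"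
        using tw twE non no_loops[OF G] by (auto simp: R_def insert_commute)
      then show ?thesis using U(2) D(2) e(1) by (auto simp: DE_def)
    qed
  qed (auto simp: W_def)
  moreover have "valency (\<C> \<union> ?D) t + chromatic_number V E \<le> card V + 1" if t: "t \<in> V" for t
  proof (cases "t \<in> W")
    case True
    then show ?thesis
      using valD[of t] U(4)[of t] D(4)[of t] DE0[of t] val[of t] chi cardW by linarith
  next
    case False
    have C0: "valency \<C> t = 0"
      using cover False by (intro valency_eq_0) (auto simp: edge_clique_cover_def)
    have "t \<in> {u, x} \<or> t \<in> {v, y}" using False t by (auto simp: W_def R_def)
    then show ?thesis
    proof
      assume t: "t \<in> {u, x}"
      have "valency DV t = 0"
        using t dist False D(1) by (intro valency_eq_0) blast
      then show ?thesis using valD[of t] star[OF U(5)[OF t]] DE[of t] C0 by linarith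
    next
      assume t: "t \<in> {v, y}"
      have "valency DU t = 0"
        using t dist False U(1) by (intro valency_eq_0) blast
      then show ?thesis using valD[of t] star[OF D(5)[OF t]] DE[of t] C0 by linarith
    qed
  qed
  ultimately show ?thesis unfolding good_cover_def by blast
qed

lemma good_cover_exists:
  assumes "simple_graph V E"
  shows "\<exists>\<C>. good_cover V E \<C>"
  using assms
proof (induction "card V" arbitrary: V E rule: less_induct)
  case less
  note G = less.prems
  have IH: "\<exists>\<C>. good_cover (V - R) (E \<inter> Pow (V - R)) \<C>" if "r \<in> R" "r \<in> V" for r R
  proof (rule less.hyps)
    show "card (V - R) < card V"
      using G that by (intro psubset_card_mono) (auto simp: simple_graph_def)
    show "simple_graph (V - R) (E \<inter> Pow (V - R))"
      using G by (rule simple_graph_induced) auto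
  qed
  show ?case
  proof (cases "clique V E")
    case True
    then show ?thesis using good_cover_complete[OF G] by blast
  next
    case False
    then obtain u v where uv: "u \<in> V" "v \<in> V" "u \<noteq> v" "{u, v} \<notin> E"
      by (auto simp: clique_def)
    then have vu: "{v, u} \<notin> E" by (simp add: insert_commute)
    consider "\<And>w. {u, w} \<in> E \<Longrightarrow> {v, w} \<in> E" | "\<And>w. {v, w} \<in> E \<Longrightarrow> {u, w} \<in> E"
      | x y where "{u, x} \<in> E" "{v, x} \<notin> E" "{v, y} \<in> E" "{u, y} \<notin> E"
      by blast
    then show ?thesis
    proof cases
      case 1
      then show ?thesis
        using good_cover_dominated[OF G uv] IH[of u "{u}"] uv by blast
    next
      case 2
      then show ?thesis
        using good_cover_dominated[OF G uv(2,1) uv(3)[symmetric] vu] IH[of v "{v}"] uv by blast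
    next
      case 3
      then show ?thesis
        using good_cover_incomparable[OF G uv(4)] IH[of u "{u, x, v, y}"] uv by blast
    qed
  qed
qed

theorem theorem1p1:
  fixes V :: "'a set" and E :: "'a set set"
  assumes "simple_graph V E"
  shows "lcc V E + chromatic_number V E \<le> card V + 1"
proof -
  obtain \<C> where C: "edge_clique_cover V E \<C>"
    and val: "\<And>v. v \<in> V \<Longrightarrow> valency \<C> v + chromatic_number V E \<le> card V + 1"
    using good_cover_exists[OF assms] by (auto simp: good_cover_def)
  have "chromatic_number V E \<le> card V"
    using assms no_loops[OF assms]
    by (intro chromatic_number_le colorable_card) (auto simp: simple_graph_def)
  moreover have "lcc V E \<le> card V + 1 - chromatic_number V E"
  proof (rule lcc_le[OF assms C])
    fix v assume "v \<in> V"
    then show "valency \<C> v \<le> card V + 1 - chromatic_number V E"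
      using val[of v] by linarith
  qed
  ultimately show ?thesis by linarith
qed

end
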